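(* Let $f\in E_k(N,\chi_f)$ and $g\in E_{k'}(N',\chi_g)$ be newforms such that $a_f(p)=a_g(p)$ for all primes $p$ in a set $S$ of primes with density $\delta(S)>1/2$. Then $k=k'$, $N=N'$, $\chi_f=\chi_g$ and $f=g$.
   Context: $E_k(N,\chi)$ denotes the space of Eisenstein series of integer weight $k\ge2$ and character $\chi$ on $\Gamma_0(N)$. For (possibly complex-valued) Dirichlet characters $\chi_1,\chi_2$ modulo $N_1,N_2$ and an integer $k\ge 2$ with $\chi_1\chi_2(-1)=(-1)^k$, excluding the case where $k=2$ and $\chi_1,\chi_2$ are both principal modulo $1$, put $$E(\chi_1,\chi_2,k)(z)=\frac{\delta(\chi_1)}{2}L(1-k,\chi_2)+\sum_{n\ge1}\sigma_{\chi_1,\chi_2}^{k-1}(n)q^n,\quad q=e^{2\pi i z},\qquad \sigma_{\chi_1,\chi_2}^{k-1}(n)=\sum_{d\mid n}\chi_1(n/d)\chi_2(d)d^{k-1},$$ where $\delta(\chi_1)=1$ if $\chi_1$ is principal and $0$ otherwise; then $E(\chi_1,\chi_2,k)\in E_k(N_1N_2,\chi_1\chi_2)$. The newforms of $E_k(N,\chi)$ are the functions $E(\chi_1,\chi_2,k)$ with $\chi_1,\chi_2$ both primitive, $N=N_1N_2$ and $\chi=\chi_1\chi_2$. The $n$th Fourier coefficient of $f$ is denoted $a_f(n)$. For a set $S$ of primes, $\delta(S)$ denotes its asymptotic (natural) density $\lim_{x\to\infty}\#\{p\in S:p\le x\}/\#\{p\text{ prime}:p\le x\}$. *)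

theory Defs
  imports "HOL-Complex_Analysis.Complex_Analysis" "HOL-Computational_Algebra.Primes"
begin

text \<open>Dirichlet characters modulo \<open>N\<close>, as functions on the integers vanishing exactly at the
  integers not coprime to \<open>N\<close>.  The only character modulo \<open>1\<close> is constantly \<open>1\<close>
  (also at \<open>0\<close>).\<close>

definition dirichlet_character :: "nat \<Rightarrow> (int \<Rightarrow> complex) \<Rightarrow> bool" where
  "dirichlet_character N \<phi> \<longleftrightarrow>
     N > 0 \<and>
     (\<forall>a b. \<phi> (a * b) = \<phi> a * \<phi> b) \<and>
     (\<forall>a. \<phi> (a + int N) = \<phi> a) \<and>
     (\<forall>a. \<phi> a \<noteq> 0 \<longleftrightarrow> coprime a (int N))"

definition principal_character :: "nat \<Rightarrow> (int \<Rightarrow> complex) \<Rightarrow> bool" where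
  "principal_character N \<phi> \<longleftrightarrow>
     dirichlet_character N \<phi> \<and> (\<forall>a. coprime a (int N) \<longrightarrow> \<phi> a = 1)"

text \<open>Primitive: not induced by a character modulo a proper divisor of the modulus.\<close>

definition primitive_character :: "nat \<Rightarrow> (int \<Rightarrow> complex) \<Rightarrow> bool" where
  "primitive_character N \<phi> \<longleftrightarrow>
     dirichlet_character N \<phi> \<and>
     \<not> (\<exists>d \<psi>. d dvd N \<and> d < N \<and> dirichlet_character d \<psi> \<and>
              (\<forall>a. coprime a (int N) \<longrightarrow> \<phi> a = \<psi> a))"

text \<open>The value at \<open>s \<noteq> 1\<close> of the Dirichlet L-function: \<open>F\<close> ranges over holomorphic
  continuations of the Dirichlet series to the plane without \<open>1\<close>, where the L-function of a
  principal character has a pole.  By the identity theorem the value does not depend on \<open>F\<close>.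
  At \<open>s = 1\<close> the definition is meaningless, even for non-principal characters.\<close>

definition dirichlet_L :: "(int \<Rightarrow> complex) \<Rightarrow> complex \<Rightarrow> complex" where
  "dirichlet_L \<phi> s =
     (THE w. \<exists>F. F holomorphic_on (UNIV - {1}) \<and>
        (\<forall>t. Re t > 1 \<longrightarrow> (\<lambda>n. \<phi> (int (Suc n)) / of_nat (Suc n) powr t) sums F t) \<and>
        w = F s)"

definition twisted_sigma ::
    "(int \<Rightarrow> complex) \<Rightarrow> (int \<Rightarrow> complex) \<Rightarrow> nat \<Rightarrow> nat \<Rightarrow> complex" where
  "twisted_sigma \<chi>1 \<chi>2 m n =
     (\<Sum>d | d dvd n. \<chi>1 (int (n div d)) * \<chi>2 (int d) * of_nat d ^ m)"

definition upper_half_plane :: "complex set" where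
  "upper_half_plane = {z. Im z > 0}"

definition q_nome :: "complex \<Rightarrow> complex" where
  "q_nome z = exp (2 * of_real pi * \<i> * z)"

text \<open>The Eisenstein series \<open>E(\<chi>1, \<chi>2, k)\<close>, meaningful on the upper half-plane only.  The
  modulus \<open>N1\<close> of \<open>\<chi>1\<close> is an argument because being principal refers to it.\<close>

definition eisenstein_E ::
    "nat \<Rightarrow> (int \<Rightarrow> complex) \<Rightarrow> (int \<Rightarrow> complex) \<Rightarrow> nat \<Rightarrow> complex \<Rightarrow> complex" where
  "eisenstein_E N1 \<chi>1 \<chi>2 k z =
     (if principal_character N1 \<chi>1 then 1 else 0) / 2 * dirichlet_L \<chi>2 (1 - of_nat k) +
     (\<Sum>n. twisted_sigma \<chi>1 \<chi>2 (k - 1) (Suc n) * q_nome z ^ Suc n)"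

text \<open>\<open>f\<close> is a newform of weight \<open>k\<close>, level \<open>N\<close> and character \<open>\<phi>\<close> in the Eisenstein space.
  The condition \<open>\<not> (k = 2 \<and> N1 = 1 \<and> N2 = 1)\<close> excludes the non-modular
  series of weight 2 attached to two characters modulo \<open>1\<close>, which are necessarily principal.
  Values of \<open>f\<close> outside the upper half-plane are unconstrained.\<close>

definition eisenstein_newform ::
    "nat \<Rightarrow> nat \<Rightarrow> (int \<Rightarrow> complex) \<Rightarrow> (complex \<Rightarrow> complex) \<Rightarrow> bool" where
  "eisenstein_newform k N \<phi> f \<longleftrightarrow>
     k \<ge> 2 \<and>
     (\<exists>N1 N2 \<chi>1 \<chi>2.
        primitive_character N1 \<chi>1 \<and> primitive_character N2 \<chi>2 \<and>
        \<chi>1 (-1) * \<chi>2 (-1) = (-1) ^ k \<and>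
        \<not> (k = 2 \<and> N1 = 1 \<and> N2 = 1) \<and>
        N = N1 * N2 \<and> \<phi> = (\<lambda>a. \<chi>1 a * \<chi>2 a) \<and>
        (\<forall>z\<in>upper_half_plane. f z = eisenstein_E N1 \<chi>1 \<chi>2 k z))"

text \<open>The coefficients of the expansion of \<open>f\<close> in powers of \<open>q\<close> on the upper half-plane.  They
  are unique since \<open>q\<close> runs through the whole punctured unit disc.\<close>

definition fourier_coeff :: "(complex \<Rightarrow> complex) \<Rightarrow> nat \<Rightarrow> complex" where
  "fourier_coeff f =
     (THE a. \<forall>z\<in>upper_half_plane. (\<lambda>n. a n * q_nome z ^ n) sums f z)"

text \<open>The set \<open>S\<close> of primes has natural density \<open>\<delta>\<close> relative to all primes; in particular
  the limit exists.\<close>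

definition has_prime_density :: "nat set \<Rightarrow> real \<Rightarrow> bool" where
  "has_prime_density S \<delta> \<longleftrightarrow>
     ((\<lambda>x::real. real (card {p \<in> S. real p \<le> x}) / real (card {p. prime p \<and> real p \<le> x}))
        \<longlongrightarrow> \<delta>) at_top"

end

theory Submission imports Defs "HOL-Number_Theory.Residues" begin

text \<open>At a prime \<open>p\<close> the coefficient is \<open>\<chi>1(p) + \<chi>2(p) p^(k-1)\<close>, so agreement at infinitely many
  primes forces equal weights, and, as \<open>\<chi>2(p)\<close> takes only finitely many values, agreement of both
  pairs of characters at all large \<open>p \<in> S\<close>.  It remains to see that two distinct primitive
  characters cannot agree on a set of primes of density above \<open>1/2\<close>.  Otherwise their quotient
  \<open>\<psi>\<close> is non-principal, so \<open>L(s, \<psi>)\<close> is bounded for real \<open>s > 1\<close>, and by the Euler product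
  \<open>\<Sum> Re \<psi>(p) p^(-s)\<close> is bounded above as \<open>s \<rightarrow> 1\<close>.  Since \<open>Re \<psi> \<ge> -1\<close> everywhere and \<open>\<psi> = 1\<close> on
  \<open>S\<close>, the weight \<open>p^(-s)\<close> carried by \<open>S\<close> is at most half of the divergent total weight.  Only an upper
  bound for \<open>ln \<bar>L(s, \<psi>)\<bar>\<close> enters, so neither the non-vanishing of \<open>L(1, \<psi>)\<close> nor the prime
  number theorem in progressions is needed.\<close>

section \<open>Euler products of completely multiplicative functions\<close>

text \<open>Sieve of Eratosthenes: the integers free of \<open>P\<close> are those also free of
  \<open>p\<close> together with \<open>p\<close> times the whole set, and complete multiplicativity
  makes the second part contribute \<open>a p\<close> times the original sum. Keeping
  \<open>1 - a p\<close> as a factor avoids inverting it.\<close>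

lemma infsum_sieve:
  fixes a :: "nat \<Rightarrow> complex"
  assumes mult: "\<And>m n. a (m * n) = a m * a n"
    and summ: "a summable_on UNIV"
    and "finite P" and "\<And>p. p \<in> P \<Longrightarrow> prime p"
  shows "infsum a {n. \<forall>p\<in>P. \<not> p dvd n} = (\<Prod>p\<in>P. 1 - a p) * infsum a UNIV"
  using assms(3,4)
proof (induction P rule: finite_induct)
  case empty
  then show ?case by simp
next
  case (insert p P)
  let ?X = "{n. \<forall>q\<in>P. \<not> q dvd n}"
  let ?Y = "{n. \<forall>q\<in>insert p P. \<not> q dvd n}"
  have p: "prime p" using insert by auto
  have sub: "a summable_on A" for A
    using summable_on_subset_banach[OF summ] by auto
  have eq: "?X = ?Y \<union> (*) p ` ?X"
  proof (intro equalityI subsetI)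
    fix n assume n: "n \<in> ?X"
    show "n \<in> ?Y \<union> (*) p ` ?X"
    proof (cases "p dvd n")
      case True
      then obtain m where m: "n = p * m" by auto
      then have "m \<in> ?X" using n by auto
      then show ?thesis using m by blast
    qed (use n in auto)
  next
    fix n assume n: "n \<in> ?Y \<union> (*) p ` ?X"
    have "\<not> q dvd p * m" if "q \<in> P" "m \<in> ?X" for q m
    proof -
      have "prime q" "q \<noteq> p" using that insert by auto
      then have "\<not> q dvd p" using p primes_dvd_imp_eq by blast
      with that \<open>prime q\<close> show ?thesis by (auto simp: prime_dvd_mult_iff)
    qed
    then show "n \<in> ?X" using n by auto
  qed
  have "infsum a ?X = infsum a (?Y \<union> (*) p ` ?X)" using eq by simp
  also have "\<dots> = infsum a ?Y + infsum a ((*) p ` ?X)"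
    by (rule infsum_Un_disjoint) (auto intro: sub)
  also have "infsum a ((*) p ` ?X) = infsum (\<lambda>n. a p * a n) ?X"
    using p by (subst infsum_reindex) (auto simp: inj_on_def o_def mult prime_gt_0_nat)
  also have "\<dots> = a p * infsum a ?X"
    by (rule infsum_cmult_right')
  finally have "infsum a ?Y + a p * infsum a ?X = infsum a ?X" by (rule sym)
  then have "infsum a ?Y = (1 - a p) * infsum a ?X"
    unfolding left_diff_distrib mult_1_left eq_diff_eq .
  also have "infsum a ?X = (\<Prod>q\<in>P. 1 - a q) * infsum a UNIV"
    by (rule insert.IH) (rule insert.prems, simp)
  finally show ?case
    using insert.hyps by (simp only: prod.insert mult.assoc not_False_eq_True)
qed

text \<open>Sieving by the primes up to \<open>x\<close> leaves 1 and integers beyond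
  \<open>x\<close>, so the error is at most a tail of an absolutely convergent series.\<close>

lemma euler_product_tendsto:
  fixes a :: "nat \<Rightarrow> complex"
  assumes mult: "\<And>m n. a (m * n) = a m * a n" and one: "a 1 = 1"
    and summ: "summable (\<lambda>n. norm (a n))"
  shows "(\<lambda>x. (\<Prod>p | prime p \<and> p \<le> x. 1 - a p) * (\<Sum>n. a n)) \<longlonglongrightarrow> 1"
proof -
  let ?L = "\<Sum>n. a n"
  have "a sums ?L" using summ summable_norm_cancel by blast
  then have hs: "(a has_sum ?L) UNIV" by (rule norm_summable_imp_has_sum[OF summ])
  then have son: "a summable_on UNIV" and L: "infsum a UNIV = ?L"
    by (auto simp: summable_on_def infsumI)
  have nson: "(\<lambda>n. norm (a n)) summable_on A" for A
    by (rule summable_on_subset_banach[of _ UNIV]) (use summ in \<open>auto simp: summable_on_UNIV_nonneg_real_iff\<close>)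
  have sub: "a summable_on A" for A
    using summable_on_subset_banach[OF son] by auto
  define T where "T = (\<Sum>n. norm (a n))"
  have nL: "((\<lambda>n. norm (a n)) has_sum T) UNIV"
    using summ summable_sums unfolding T_def by (intro norm_summable_imp_has_sum) auto
  have bound: "norm ((\<Prod>p | prime p \<and> p \<le> x. 1 - a p) * ?L - 1) \<le> T - (\<Sum>n\<le>x. norm (a n))"
    if x: "x \<ge> 2" for x
  proof -
    let ?X = "{n. \<forall>p\<in>{p. prime p \<and> p \<le> x}. \<not> p dvd n}"
    have one_in: "1 \<in> ?X" by (auto simp: prime_nat_iff)
    have sub': "?X - {1} \<subseteq> {x<..}"
    proof
      fix n assume n: "n \<in> ?X - {1}"
      then obtain p where p: "prime p" "p dvd n" using prime_factor_nat[of n] by auto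
      \<comment> \<open>This excludes \<open>n = 0\<close>, which every prime divides;
        \<open>x \<ge> 2\<close> puts 2 among the sieving primes.\<close>
      have "\<not> 2 dvd n" using n x two_is_prime_nat by blast
      then have "n \<noteq> 0" by (metis dvd_0_right)
      with p have "p \<le> n" by (auto dest: dvd_imp_le)
      then show "n \<in> {x<..}" using n p by auto
    qed
    have "(\<Prod>p | prime p \<and> p \<le> x. 1 - a p) * ?L = infsum a ?X"
      by (subst infsum_sieve[OF mult son]) (auto simp: L)
    also have "?X = {1} \<union> (?X - {1})" using one_in by blast
    also have "infsum a \<dots> = 1 + infsum a (?X - {1})"
      by (subst infsum_Un_disjoint) (auto simp: one[simplified] intro: sub)
    finally have "norm ((\<Prod>p | prime p \<and> p \<le> x. 1 - a p) * ?L - 1) = norm (infsum a (?X - {1}))"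
      by simp
    also have "\<dots> \<le> infsum (\<lambda>n. norm (a n)) (?X - {1})"
      by (rule norm_infsum_bound) (rule nson)
    also have "\<dots> \<le> infsum (\<lambda>n. norm (a n)) {x<..}"
      by (rule infsum_mono_neutral[OF nson nson]) (use sub' in auto)
    also have "\<dots> = T - (\<Sum>n\<le>x. norm (a n))"
    proof -
      have "{..x} \<union> {x<..} = UNIV" by auto
      then have "T = infsum (\<lambda>n. norm (a n)) ({..x} \<union> {x<..})"
        using infsumI[OF nL] by simp
      also have "\<dots> = (\<Sum>n\<le>x. norm (a n)) + infsum (\<lambda>n. norm (a n)) {x<..}"
        by (subst infsum_Un_disjoint) (auto intro: nson)
      finally show ?thesis by simp
    qed
    finally show ?thesis .
  qed
  have "(\<lambda>n. norm (a n)) sums T" using summ unfolding T_def by auto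
  then have "(\<lambda>x. T - (\<Sum>n\<le>x. norm (a n))) \<longlonglongrightarrow> T - T"
    unfolding sums_def_le by (intro tendsto_intros)
  then have lim: "(\<lambda>x. T - (\<Sum>n\<le>x. norm (a n))) \<longlonglongrightarrow> 0"
    by (simp only: diff_self)
  have "eventually (\<lambda>x. norm ((\<Prod>p | prime p \<and> p \<le> x. 1 - a p) * ?L - 1)
      \<le> T - (\<Sum>n\<le>x. norm (a n))) sequentially"
    using eventually_ge_at_top[of 2] by (rule eventually_mono) (rule bound)
  then have "(\<lambda>x. (\<Prod>p | prime p \<and> p \<le> x. 1 - a p) * ?L - 1) \<longlonglongrightarrow> 0"
    using lim by (rule Lim_null_comparison)
  then show ?thesis by (rule LIM_zero_cancel)
qed

section \<open>Elementary inequalities and summation by parts\<close>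

text \<open>Squaring reduces this to \<open>1 + t \<le> exp t\<close>. It bounds Euler factors from
  above without complex logarithms.\<close>

lemma norm_one_minus_le_exp:
  fixes z :: complex
  shows "norm (1 - z) \<le> exp ((norm z)\<^sup>2 / 2 - Re z)"
proof -
  have "(norm (1 - z))\<^sup>2 = 1 + ((norm z)\<^sup>2 - 2 * Re z)"
    unfolding cmod_power2 by (simp add: power2_eq_square algebra_simps)
  also have "\<dots> \<le> exp ((norm z)\<^sup>2 - 2 * Re z)"
    by (rule exp_ge_add_one_self)
  also have "\<dots> = (exp ((norm z)\<^sup>2 / 2 - Re z))\<^sup>2"
    by (simp add: exp_double[symmetric] algebra_simps)
  finally show ?thesis by (rule power2_le_imp_le) simp
qed

text \<open>On this range \<open>(1 - x) * (1 + 2 * x) = 1 + x * (1 - 2 * x)\<close> is at least 1,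
  and \<open>1 + 2 * x \<le> exp (2 * x)\<close>. The range covers \<open>x = p powr - s\<close> for
  primes \<open>p\<close> and \<open>s > 1\<close>.\<close>

lemma exp_minus_double_le:
  fixes x :: real
  assumes "0 \<le> x" "x \<le> 1 / 2"
  shows "exp (- 2 * x) \<le> 1 - x"
proof -
  have "1 \<le> (1 - x) * (1 + 2 * x)"
    using mult_nonneg_nonneg[of x "1 - 2 * x"] assms by (simp add: algebra_simps)
  also have "\<dots> \<le> (1 - x) * exp (2 * x)"
    using assms by (intro mult_left_mono exp_ge_add_one_self) auto
  finally show ?thesis by (simp add: exp_minus field_simps)
qed

text \<open>One-sided summation by parts, in the form suited to counting functions that are only
  bounded from below.\<close>

lemma sum_mult_antimono_ge:
  fixes d f :: "nat \<Rightarrow> real"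
  assumes f0: "\<And>n. n \<ge> 1 \<Longrightarrow> 0 \<le> f n"
    and anti: "\<And>n. n \<ge> 1 \<Longrightarrow> f (Suc n) \<le> f n"
    and D: "\<And>n. - C \<le> (\<Sum>i=1..n. d i)"
  shows "- C * f 1 \<le> (\<Sum>i=1..n. d i * f i)"
proof -
  have C: "C \<ge> 0" using D[of 0] by simp
  \<comment> \<open>The induction carries the surplus
    \<open>((\<Sum>i=1..n. d i) + C) * f n\<close>. Its first factor is nonnegative, so
    \<open>f n\<close> may be lowered to \<open>f (Suc n)\<close> at each step and the surplus
    dropped at the end.\<close>
  have *: "- C * f 1 + ((\<Sum>i=1..n. d i) + C) * f n \<le> (\<Sum>i=1..n. d i * f i)" if "n \<ge> 1" for n
    using that
  proof (induction n rule: nat_induct_at_least)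
    case base
    then show ?case by (simp add: algebra_simps)
  next
    case (Suc n)
    have "((\<Sum>i=1..n. d i) + C) * f (Suc n) \<le> ((\<Sum>i=1..n. d i) + C) * f n"
      using D[of n] anti[OF Suc.hyps] by (intro mult_left_mono) auto
    then show ?case using Suc.IH by (simp add: algebra_simps)
  qed
  show ?thesis
  proof (cases "n \<ge> 1")
    case True
    have "0 \<le> ((\<Sum>i=1..n. d i) + C) * f n" using D[of n] f0[OF True] by simp
    then show ?thesis using *[OF True] by linarith
  next
    case False
    then have "n = 0" by simp
    then show ?thesis using C f0[of 1] by simp
  qed
qed

text \<open>The one-sided bound is applied to the real and imaginary parts and to their negatives;
  adding the two parts costs the factor 2.\<close>

lemma norm_sum_mult_antimono_le:
  fixes d :: "nat \<Rightarrow> complex" and f :: "nat \<Rightarrow> real"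
  assumes f0: "\<And>n. n \<ge> 1 \<Longrightarrow> 0 \<le> f n"
    and anti: "\<And>n. n \<ge> 1 \<Longrightarrow> f (Suc n) \<le> f n"
    and D: "\<And>n. norm (\<Sum>i=1..n. d i) \<le> B"
  shows "norm (\<Sum>i=1..n. d i * of_real (f i)) \<le> 2 * B * f 1"
proof -
  have re: "\<bar>\<Sum>i=1..n. Re (d i)\<bar> \<le> B" and im: "\<bar>\<Sum>i=1..n. Im (d i)\<bar> \<le> B" for n
    using D[of n] abs_Re_le_cmod[of "\<Sum>i=1..n. d i"] abs_Im_le_cmod[of "\<Sum>i=1..n. d i"]
    by simp_all
  have gen: "\<bar>\<Sum>i=1..n. e i * f i\<bar> \<le> B * f 1" if "\<And>n. \<bar>\<Sum>i=1..n. e i\<bar> \<le> B" for e :: "nat \<Rightarrow> real"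
  proof -
    have "- B * f 1 \<le> (\<Sum>i=1..n. e i * f i)"
      using that by (intro sum_mult_antimono_ge[where f = f, OF f0 anti]) (auto simp: abs_le_iff minus_le_iff)
    moreover have "- B * f 1 \<le> (\<Sum>i=1..n. - e i * f i)"
      using that by (intro sum_mult_antimono_ge[where f = f, OF f0 anti]) (auto simp: abs_le_iff sum_negf)
    ultimately show ?thesis by (simp add: sum_negf abs_le_iff)
  qed
  have "norm (\<Sum>i=1..n. d i * of_real (f i)) \<le>
      \<bar>Re (\<Sum>i=1..n. d i * of_real (f i))\<bar> + \<bar>Im (\<Sum>i=1..n. d i * of_real (f i))\<bar>"
    by (rule cmod_le)
  also have "\<dots> \<le> B * f 1 + B * f 1"
    using gen[OF re] gen[OF im] by simp
  finally show ?thesis by simp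
qed

section \<open>Density of the primes where a character is trivial\<close>

lemma powr_minus_Suc_le:
  fixes s :: real
  assumes "s \<ge> 0" "n \<ge> 1"
  shows "real (Suc n) powr - s \<le> real n powr - s"
  using assms by (intro powr_mono2') auto

text \<open>Keeps the quadratic terms of the Euler product below a convergent series independent of
  \<open>s\<close>.\<close>

lemma powr_le_inverse_square:
  assumes "s \<ge> 1"
  shows "(real n powr - s)\<^sup>2 \<le> real n powr - 2"
proof (cases "n = 0")
  case False
  have "(real n powr - s)\<^sup>2 = real n powr (- 2 * s)"
    using False by (simp add: powr_power)
  also have "\<dots> \<le> real n powr - 2"
    using False assms by (intro powr_mono) auto
  finally show ?thesis .
qed simp

text \<open>Summation by parts. The point is uniformity in \<open>s\<close>: the bound persists as
  \<open>s\<close> tends to 1.\<close>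

lemma norm_suminf_twisted_powr_le:
  fixes \<psi> :: "nat \<Rightarrow> complex"
  assumes B: "\<And>n. norm (\<Sum>i=1..n. \<psi> i) \<le> B"
    and s: "s \<ge> 0" and summ: "summable (\<lambda>n. \<psi> n * of_real (real n powr - s))"
  shows "norm (\<Sum>n. \<psi> n * of_real (real n powr - s)) \<le> 2 * B"
proof -
  let ?a = "\<lambda>n. \<psi> n * of_real (real n powr - s)"
  have "(\<lambda>x. \<Sum>n\<le>x. ?a n) \<longlonglongrightarrow> (\<Sum>n. ?a n)"
    using summ summable_LIMSEQ' by blast
  then have "(\<lambda>x. norm (\<Sum>n\<le>x. ?a n)) \<longlonglongrightarrow> norm (\<Sum>n. ?a n)"
    by (rule tendsto_norm)
  moreover have "norm (\<Sum>n\<le>x. ?a n) \<le> 2 * B" for x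
  proof -
    \<comment> \<open>The term at 0 vanishes because \<open>0 powr - s\<close> is 0.\<close>
    have "(\<Sum>n\<le>x. ?a n) = (\<Sum>n=1..x. ?a n)"
      by (rule sum.mono_neutral_right) (auto simp: not_le)
    also have "norm \<dots> \<le> 2 * B * (real 1 powr - s)"
      by (rule norm_sum_mult_antimono_le[where f = "\<lambda>n. real n powr - s", OF _ powr_minus_Suc_le B]) (use s in auto)
    finally show ?thesis by simp
  qed
  ultimately show ?thesis
    by (intro tendsto_upperbound) auto
qed

text \<open>Norms are taken in the Euler product: the series is at most \<open>2 * B\<close>, each
  factor is at most the exponential in \<open>norm_one_minus_le_exp\<close>, and their product tends
  to 1. The bound is the same for all \<open>s > 1\<close>; only the threshold for \<open>x\<close>
  depends on \<open>s\<close>.\<close>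

lemma sum_Re_primes_le:
  fixes \<psi> :: "nat \<Rightarrow> complex"
  assumes mult: "\<And>m n. \<psi> (m * n) = \<psi> m * \<psi> n" and one: "\<psi> 1 = 1"
    and le1: "\<And>n. norm (\<psi> n) \<le> 1"
    and B: "\<And>n. norm (\<Sum>i=1..n. \<psi> i) \<le> B"
    and s: "s > 1"
  shows "eventually (\<lambda>x. (\<Sum>p | prime p \<and> p \<le> x. Re (\<psi> p) * real p powr - s)
           \<le> (\<Sum>n. real n powr - 2) / 2 + ln (4 * B)) sequentially"
proof -
  define w where "w = (\<lambda>n::nat. real n powr - s)"
  define a where "a = (\<lambda>n. \<psi> n * of_real (w n))"
  define L where "L = (\<Sum>n. a n)"
  define Q where "Q = (\<Sum>n. real n powr - 2)"
  have amult: "a (m * n) = a m * a n" for m n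
    by (simp add: a_def w_def mult powr_mult)
  have aone: "a 1 = 1" using one by (simp add: a_def w_def)
  have norm_a: "norm (a n) \<le> w n" for n
    using mult_right_mono[OF le1, of "w n" n] by (simp add: a_def w_def norm_mult)
  have "summable w" using s by (simp add: w_def summable_real_powr_iff)
  then have summ: "summable (\<lambda>n. norm (a n))"
    by (rule summable_comparison_test') (use norm_a in auto)
  have L: "norm L \<le> 2 * B"
    unfolding L_def a_def w_def
    by (rule norm_suminf_twisted_powr_le[OF B]) (use s summable_norm_cancel[OF summ] in \<open>auto simp: a_def w_def\<close>)
  have "(\<lambda>x. norm ((\<Prod>p | prime p \<and> p \<le> x. 1 - a p) * L)) \<longlonglongrightarrow> norm (1::complex)"
    unfolding L_def by (intro tendsto_norm euler_product_tendsto[OF amult aone summ])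
  \<comment> \<open>Any constant below the limit 1 would do; \<open>1 / 2\<close> against
    \<open>2 * B\<close> produces the \<open>4 * B\<close> in the statement.\<close>
  then have "eventually (\<lambda>x. norm ((\<Prod>p | prime p \<and> p \<le> x. 1 - a p) * L) > 1 / 2) sequentially"
    by (rule order_tendstoD) simp
  then show ?thesis
  proof (rule eventually_mono)
    fix x assume x: "norm ((\<Prod>p | prime p \<and> p \<le> x. 1 - a p) * L) > 1 / 2"
    let ?P = "{p. prime p \<and> p \<le> x}"
    have fin: "finite ?P" by simp
    have sq: "(\<Sum>p\<in>?P. (norm (a p))\<^sup>2) \<le> Q"
    proof -
      have "(\<Sum>p\<in>?P. (norm (a p))\<^sup>2) \<le> (\<Sum>p\<in>?P. real p powr - 2)"
      proof (rule sum_mono)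
        fix p
        have "(norm (a p))\<^sup>2 \<le> (w p)\<^sup>2" using norm_a by (intro power_mono) auto
        also have "\<dots> \<le> real p powr - 2" unfolding w_def using s by (intro powr_le_inverse_square) auto
        finally show "(norm (a p))\<^sup>2 \<le> real p powr - 2" .
      qed
      also have "\<dots> \<le> Q" unfolding Q_def
        by (rule sum_le_suminf) (auto simp: summable_real_powr_iff)
      finally show ?thesis .
    qed
    have Re: "(\<Sum>p\<in>?P. Re (a p)) = (\<Sum>p\<in>?P. Re (\<psi> p) * w p)"
      by (simp add: a_def)
    have "norm (\<Prod>p\<in>?P. 1 - a p) \<le> (\<Prod>p\<in>?P. exp ((norm (a p))\<^sup>2 / 2 - Re (a p)))"
      unfolding prod_norm[symmetric] by (intro prod_mono) (auto intro: norm_one_minus_le_exp)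
    also have "\<dots> = exp ((\<Sum>p\<in>?P. (norm (a p))\<^sup>2) / 2 - (\<Sum>p\<in>?P. Re (a p)))"
      by (simp add: exp_sum[symmetric] sum_subtractf sum_divide_distrib)
    also have "\<dots> \<le> exp (Q / 2 - (\<Sum>p\<in>?P. Re (a p)))"
      using sq by simp
    finally have le: "norm (\<Prod>p\<in>?P. 1 - a p) \<le> exp (Q / 2 - (\<Sum>p\<in>?P. Re (a p)))" .
    have "1 / 2 < norm (\<Prod>p\<in>?P. 1 - a p) * norm L" using x by (simp add: norm_mult)
    also have "\<dots> \<le> exp (Q / 2 - (\<Sum>p\<in>?P. Re (a p))) * (2 * B)"
      using le L by (intro mult_mono) auto
    finally have *: "1 / 2 < exp (Q / 2 - (\<Sum>p\<in>?P. Re (a p))) * (2 * B)" .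
    \<comment> \<open>The strict inequality forces \<open>B > 0\<close>, so that
      \<open>exp (ln (4 * B))\<close> is \<open>4 * B\<close>.\<close>
    then have "0 < exp (Q / 2 - (\<Sum>p\<in>?P. Re (a p))) * (2 * B)" by linarith
    then have "B > 0" by (simp add: zero_less_mult_iff)
    have "1 / 2 < exp (Q / 2) * (2 * B) / exp (\<Sum>p\<in>?P. Re (a p))"
      using * by (simp only: exp_diff times_divide_eq_left)
    then have "1 / 2 * exp (\<Sum>p\<in>?P. Re (a p)) < exp (Q / 2) * (2 * B)"
      by (simp only: pos_less_divide_eq[OF exp_gt_zero])
    then have "exp (\<Sum>p\<in>?P. Re (a p)) \<le> exp (Q / 2) * (4 * B)"
      by linarith
    also have "\<dots> = exp (Q / 2 + ln (4 * B))"
      using \<open>B > 0\<close> by (simp add: exp_add)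
    finally show "(\<Sum>p\<in>?P. Re (\<psi> p) * real p powr - s) \<le> (\<Sum>n. real n powr - 2) / 2 + ln (4 * B)"
      using Re by (simp add: Q_def w_def)
  qed
qed

section \<open>Divergence of the sum over primes as \<open>s\<close> tends to 1\<close>

text \<open>The Euler product of the zeta function read in the other direction: factors at least
  \<open>exp (- 2 * w p)\<close> keep the product above \<open>exp (- 2 * K)\<close>, while the
  product times the series tends to 1.\<close>

lemma suminf_powr_le_prime_sum:
  assumes s: "s > 1"
    and K: "eventually (\<lambda>x. (\<Sum>p | prime p \<and> p \<le> x. real p powr - s) \<le> K) sequentially"
  shows "(\<Sum>n. real n powr - s) \<le> exp (2 * K)"
proof -
  define w where "w = (\<lambda>n::nat. real n powr - s)"
  define Z where "Z = (\<Sum>n. w n)"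
  have summ: "summable w" using s by (simp add: w_def summable_real_powr_iff)
  have Z0: "Z \<ge> 0" unfolding Z_def by (rule suminf_nonneg[OF summ]) (simp add: w_def)
  have Z: "(\<Sum>n. complex_of_real (w n)) = of_real Z"
    unfolding Z_def using summ by (rule suminf_of_real[symmetric])
  have "(\<lambda>x. (\<Prod>p | prime p \<and> p \<le> x. 1 - complex_of_real (w p)) * (\<Sum>n. complex_of_real (w n))) \<longlonglongrightarrow> 1"
    by (rule euler_product_tendsto) (use summ in \<open>auto simp: w_def powr_mult\<close>)
  then have "(\<lambda>x. Re ((\<Prod>p | prime p \<and> p \<le> x. 1 - complex_of_real (w p)) * (\<Sum>n. complex_of_real (w n)))) \<longlonglongrightarrow> Re 1"
    by (rule tendsto_Re)
  moreover have "Re ((\<Prod>p | prime p \<and> p \<le> x. 1 - complex_of_real (w p)) * (\<Sum>n. complex_of_real (w n))) =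
      (\<Prod>p | prime p \<and> p \<le> x. 1 - w p) * Z" for x
  proof -
    have "(\<Prod>p | prime p \<and> p \<le> x. 1 - complex_of_real (w p)) * (\<Sum>n. complex_of_real (w n)) =
      of_real ((\<Prod>p | prime p \<and> p \<le> x. 1 - w p) * Z)"
      by (simp add: Z)
    then show ?thesis by (metis Re_complex_of_real)
  qed
  ultimately have lim: "(\<lambda>x. (\<Prod>p | prime p \<and> p \<le> x. 1 - w p) * Z) \<longlonglongrightarrow> 1" by simp
  have "eventually (\<lambda>x. exp (- 2 * K) * Z \<le> (\<Prod>p | prime p \<and> p \<le> x. 1 - w p) * Z) sequentially"
    using K
  proof (rule eventually_mono)
    fix x assume x: "(\<Sum>p | prime p \<and> p \<le> x. real p powr - s) \<le> K"
    let ?P = "{p. prime p \<and> p \<le> x}"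
    have "exp (- 2 * K) \<le> exp (\<Sum>p\<in>?P. - 2 * w p)"
      using x by (simp add: w_def sum_distrib_left[symmetric] sum_negf)
    also have "\<dots> = (\<Prod>p\<in>?P. exp (- 2 * w p))"
      by (rule exp_sum) simp
    also have "\<dots> \<le> (\<Prod>p\<in>?P. 1 - w p)"
    proof (rule prod_mono, safe)
      fix p :: nat assume p: "prime p"
      \<comment> \<open>\<open>s > 1\<close> and \<open>p \<ge> 2\<close> bring \<open>w p\<close>
        into the range of \<open>exp_minus_double_le\<close>.\<close>
      have "w p \<le> real p powr - 1"
        unfolding w_def using s prime_ge_1_nat[OF p] by (intro powr_mono) auto
      also have "\<dots> \<le> 1 / 2" using prime_ge_2_nat[OF p] by (simp add: powr_minus field_simps)
      finally have "w p \<le> 1 / 2" .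
      then show "exp (- 2 * w p) \<le> 1 - w p"
        by (intro exp_minus_double_le) (auto simp: w_def)
    qed simp
    finally show "exp (- 2 * K) * Z \<le> (\<Prod>p | prime p \<and> p \<le> x. 1 - w p) * Z"
      using Z0 by (rule mult_right_mono)
  qed
  then have "exp (- 2 * K) * Z \<le> 1"
    by (intro tendsto_lowerbound[OF lim]) auto
  then show ?thesis by (simp add: exp_minus field_simps Z_def w_def)
qed

text \<open>As \<open>K\<close> is fixed before \<open>s\<close>, it bounds the zeta series
  uniformly; letting \<open>s\<close> tend to 1 in each finite partial sum would bound the harmonic
  numbers.\<close>

lemma prime_sum_powr_unbounded:
  assumes K: "\<And>s. s > 1 \<Longrightarrow>
    eventually (\<lambda>x. (\<Sum>p | prime p \<and> p \<le> x. real p powr - s) \<le> K) sequentially"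
  shows False
proof -
  have *: "(\<Sum>n=1..m. real n powr - s) \<le> exp (2 * K)" if s: "s > 1" for s m
  proof -
    have "(\<Sum>n=1..m. real n powr - s) \<le> (\<Sum>n. real n powr - s)"
      by (rule sum_le_suminf) (use s in \<open>auto simp: summable_real_powr_iff\<close>)
    also have "\<dots> \<le> exp (2 * K)" by (rule suminf_powr_le_prime_sum[OF s K[OF s]])
    finally show ?thesis .
  qed
  have bound: "harm m \<le> exp (2 * K)" for m
  proof -
    have "((\<lambda>s. \<Sum>n=1..m. real n powr - s) \<longlongrightarrow> (\<Sum>n=1..m. real n powr - 1)) (at_right 1)"
      by (intro tendsto_intros) auto
    moreover have "eventually (\<lambda>s. (\<Sum>n=1..m. real n powr - s) \<le> exp (2 * K)) (at_right 1)"
      using * by (auto simp: eventually_at_right_field intro!: exI[of _ 2])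
    ultimately have "(\<Sum>n=1..m. real n powr - 1) \<le> exp (2 * K)"
      by (intro tendsto_upperbound) auto
    then show ?thesis by (simp add: harm_def powr_minus)
  qed
  have "eventually (\<lambda>m. harm m > exp (2 * K)) sequentially"
    using harm_at_top filterlim_at_top_dense by blast
  then obtain m where "harm m > exp (2 * K)" by (auto simp: eventually_sequentially)
  with bound[of m] show False by simp
qed

text \<open>Indicator form, so that sums over primes become sums over \<open>1..n\<close> open to
  summation by parts.\<close>

lemma sum_primes_eq:
  fixes h :: "nat \<Rightarrow> real"
  shows "(\<Sum>i=1..n. of_bool (prime i) * h i) = (\<Sum>p | prime p \<and> p \<le> n. h p)"
  by (intro sum.mono_neutral_cong_right) (auto simp: Suc_le_eq prime_gt_0_nat)

text \<open>The constants \<open>C\<close> and \<open>p0\<close> contribute at most \<open>C\<close> and \<open>p0\<close> to the weighted sums, uniformly in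
  \<open>s > 1\<close>, because \<open>i powr -s \<le> 1\<close>.\<close>

lemma character_eq_one_density:
  fixes \<psi> :: "nat \<Rightarrow> complex"
  assumes mult: "\<And>m n. \<psi> (m * n) = \<psi> m * \<psi> n" and one: "\<psi> 1 = 1"
    and le1: "\<And>n. norm (\<psi> n) \<le> 1"
    and B: "\<And>n. norm (\<Sum>i=1..n. \<psi> i) \<le> B"
    and S: "\<And>p. p \<in> S \<Longrightarrow> prime p"
    and c: "c > 1 / 2"
    and D: "\<And>n. c * real (card {p. prime p \<and> p \<le> n}) - C \<le> real (card {p \<in> S. p \<le> n})"
    and eq: "\<And>p. p \<in> S \<Longrightarrow> p \<ge> p0 \<Longrightarrow> \<psi> p = 1"
  shows False
proof -
  \<comment> \<open>The final inequality, solved for the prime sum by dividing by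
    \<open>2 * c - 1\<close>, which is positive as \<open>c > 1 / 2\<close>. Since \<open>K\<close>
    does not involve \<open>s\<close>, it contradicts
    \<open>prime_sum_powr_unbounded\<close>.\<close>
  define K where "K = ((\<Sum>n. real n powr - 2) / 2 + ln (4 * B) + 2 * C + 2 * real p0) / (2 * c - 1)"
  have "eventually (\<lambda>x. (\<Sum>p | prime p \<and> p \<le> x. real p powr - s) \<le> K) sequentially" if s: "s > 1" for s
    using sum_Re_primes_le[OF mult one le1 B s]
  proof (rule eventually_mono)
    fix x assume x: "(\<Sum>p | prime p \<and> p \<le> x. Re (\<psi> p) * real p powr - s)
           \<le> (\<Sum>n. real n powr - 2) / 2 + ln (4 * B)"
    let ?w = "\<lambda>n. real n powr - s"
    let ?S = "\<lambda>i. of_bool (i \<in> S) :: real"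
    let ?P = "\<lambda>i::nat. of_bool (prime i) :: real"
    let ?I = "\<lambda>i. of_bool (i < p0) :: real"
    have w1: "?w i \<le> 1" if "i \<ge> 1" for i
      using powr_mono[of "- s" 0 "real i"] that s by simp
    have cS: "(\<Sum>i=1..n. ?S i) = real (card {p \<in> S. p \<le> n})" for n
    proof -
      have "(\<Sum>i=1..n. ?S i) = (\<Sum>p | p \<in> S \<and> p \<le> n. 1)"
        by (intro sum.mono_neutral_cong_right) (auto dest: S simp: Suc_le_eq prime_gt_0_nat)
      then show ?thesis by simp
    qed
    have cP: "(\<Sum>i=1..n. ?P i) = real (card {p. prime p \<and> p \<le> n})" for n
      using sum_primes_eq[of "\<lambda>_. 1" n] by simp
    \<comment> \<open>Summation by parts for the indicator of \<open>S\<close> minus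
      \<open>c\<close> times that of the primes: its partial sums are at least \<open>- C\<close> by
      \<open>D\<close>, which carries the counting bound over to the weights.\<close>
    have "- C * ?w 1 \<le> (\<Sum>i=1..x. (?S i - c * ?P i) * ?w i)"
    proof (rule sum_mult_antimono_ge[where f = ?w, OF _ powr_minus_Suc_le])
      fix n
      have "(\<Sum>i=1..n. ?S i - c * ?P i) = (\<Sum>i=1..n. ?S i) - c * (\<Sum>i=1..n. ?P i)"
        by (simp only: sum_subtractf sum_distrib_left)
      then show "- C \<le> (\<Sum>i=1..n. ?S i - c * ?P i)"
        using D[of n] unfolding cS cP by linarith
    qed (use s in auto)
    also have "\<dots> = (\<Sum>i=1..x. ?S i * ?w i) - c * (\<Sum>i=1..x. ?P i * ?w i)"
      by (simp only: sum_subtractf left_diff_distrib sum_distrib_left mult.assoc)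
    finally have 1: "c * (\<Sum>i=1..x. ?P i * ?w i) - C \<le> (\<Sum>i=1..x. ?S i * ?w i)"
      unfolding of_nat_1 powr_one_eq_one by linarith
    have "(\<Sum>i=1..x. ?I i * ?w i) \<le> (\<Sum>i=1..x. ?I i)"
      using w1 by (intro sum_mono) auto
    also have "\<dots> = real (card ({1..x} \<inter> {i. i < p0}))"
      by simp
    also have "\<dots> \<le> real p0"
      using card_mono[of "{..<p0}" "{1..x} \<inter> {i. i < p0}"] by auto
    finally have 2: "(\<Sum>i=1..x. ?I i * ?w i) \<le> real p0" .
    have "2 * (\<Sum>i=1..x. ?S i * ?w i) - (\<Sum>i=1..x. ?P i * ?w i) - 2 * (\<Sum>i=1..x. ?I i * ?w i)
        = (\<Sum>i=1..x. (2 * ?S i - ?P i - 2 * ?I i) * ?w i)"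
      by (simp only: sum_subtractf left_diff_distrib sum_distrib_left mult.assoc)
    also have "\<dots> \<le> (\<Sum>i=1..x. ?P i * (Re (\<psi> i) * ?w i))"
      unfolding mult.assoc[symmetric]
    proof (intro sum_mono mult_right_mono)
      fix i
      have "- 1 \<le> Re (\<psi> i)" using abs_Re_le_cmod[of "\<psi> i"] le1[of i] by linarith
      \<comment> \<open>On \<open>S\<close> from \<open>p0\<close> on both sides are 1; on
        \<open>S\<close> below \<open>p0\<close> the left side is -1; at other primes it is at most
        -1, and at composite \<open>i\<close> at most 0.\<close>
      then show "2 * ?S i - ?P i - 2 * ?I i \<le> ?P i * Re (\<psi> i)"
        using S[of i] eq[of i] by (cases "i \<in> S"; cases "prime i"; cases "i < p0") auto
    qed simp
    also have "\<dots> \<le> (\<Sum>n. real n powr - 2) / 2 + ln (4 * B)"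
      using x by (simp only: sum_primes_eq)
    finally have "(2 * c - 1) * (\<Sum>i=1..x. ?P i * ?w i) \<le>
       (\<Sum>n. real n powr - 2) / 2 + ln (4 * B) + 2 * C + 2 * real p0"
      using 1 2 unfolding left_diff_distrib mult.assoc by linarith
    then show "(\<Sum>p | prime p \<and> p \<le> x. ?w p) \<le> K"
      using c by (simp only: sum_primes_eq) (simp add: K_def field_simps)
  qed
  then show False by (rule prime_sum_powr_unbounded)
qed

section \<open>Dirichlet characters\<close>

lemma dirichlet_character_cong:
  assumes "dirichlet_character N \<phi>" and "[a = b] (mod int N)"
  shows "\<phi> a = \<phi> b"
proof -
  have per: "\<phi> (a + int N) = \<phi> a" for a
    using assms(1) by (simp add: dirichlet_character_def)
  have n: "\<phi> (a + int m * int N) = \<phi> a" for a m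
  proof (induction m)
    case (Suc m)
    then show ?case using per[of "a + int m * int N"] by (simp add: algebra_simps)
  qed simp
  obtain k where k: "b = a + int N * k" using assms(2) cong_iff_lin by blast
  show ?thesis
  proof (cases "k \<ge> 0")
    case True
    then show ?thesis using n[of a "nat k"] k by (simp add: mult.commute)
  next
    case False
    then have "a = b + int (nat (- k)) * int N" using k by (simp add: algebra_simps)
    then show ?thesis using n[of b "nat (- k)"] by simp
  qed
qed

lemma dirichlet_character_one:
  assumes "dirichlet_character N \<phi>"
  shows "\<phi> 1 = 1"
proof -
  have "\<phi> 1 = \<phi> 1 * \<phi> 1" using assms unfolding dirichlet_character_def by (metis mult_1)
  moreover have "\<phi> 1 \<noteq> 0" using assms by (simp add: dirichlet_character_def)
  ultimately show ?thesis by simp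
qed

text \<open>By Euler's theorem the value is a root of unity of order dividing
  \<open>totient N\<close>.\<close>

lemma dirichlet_character_norm_eq_1:
  assumes "dirichlet_character N \<phi>" and "coprime a (int N)"
  shows "norm (\<phi> a) = 1"
proof -
  have N: "N > 0" and mult: "\<And>a b. \<phi> (a * b) = \<phi> a * \<phi> b"
    using assms(1) by (auto simp: dirichlet_character_def)
  define b where "b = nat (a mod int N)"
  have b: "int b = a mod int N" using N by (simp add: b_def)
  have "coprime (int b) (int N)" using assms(2) N unfolding b by simp
  then have "[b ^ totient N = 1] (mod N)" by (intro euler_theorem) simp
  then have "[int (b ^ totient N) = int 1] (mod int N)" by (simp only: cong_int_iff)
  then have "\<phi> (int b ^ totient N) = \<phi> 1"
    by (intro dirichlet_character_cong[OF assms(1)]) simp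
  moreover have "\<phi> (c ^ n) = \<phi> c ^ n" for c n
    by (induction n) (simp_all add: mult dirichlet_character_one[OF assms(1)])
  ultimately have "\<phi> (int b) ^ totient N = 1"
    by (simp add: dirichlet_character_one[OF assms(1)])
  then have "norm (\<phi> (int b)) ^ totient N = 1 ^ totient N"
    by (metis norm_power norm_one power_one)
  then have "norm (\<phi> (int b)) = 1"
    by (rule power_eq_imp_eq_base) (use N in auto)
  moreover have "\<phi> (int b) = \<phi> a"
    by (rule dirichlet_character_cong[OF assms(1)]) (simp add: b)
  ultimately show ?thesis by simp
qed

lemma dirichlet_character_norm_le_1:
  assumes "dirichlet_character N \<phi>"
  shows "norm (\<phi> a) \<le> 1"
proof (cases "coprime a (int N)")
  case False
  then have "\<phi> a = 0" using assms by (auto simp: dirichlet_character_def)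
  then show ?thesis by simp
qed (use dirichlet_character_norm_eq_1[OF assms] in simp)

text \<open>Multiplication by \<open>a\<close> permutes the residues, so the sum equals
  \<open>\<phi> a\<close> times itself.\<close>

lemma sum_dirichlet_character_eq_0:
  assumes \<phi>: "dirichlet_character N \<phi>" and a: "coprime a (int N)" "\<phi> a \<noteq> 1"
  shows "(\<Sum>r\<in>{0..<int N}. \<phi> r) = 0"
proof -
  let ?R = "{0..<int N}"
  have N: "N > 0" and mult: "\<And>a b. \<phi> (a * b) = \<phi> a * \<phi> b"
    using \<phi> by (auto simp: dirichlet_character_def)
  have inj: "inj_on (\<lambda>r. (a * r) mod int N) ?R"
  proof (rule inj_onI)
    fix r r' assume r: "r \<in> ?R" "r' \<in> ?R" "(a * r) mod int N = (a * r') mod int N"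
    then have "[a * r = a * r'] (mod int N)" by (simp add: cong_def)
    then have "[r = r'] (mod int N)" using a(1) by (simp add: cong_mult_lcancel)
    then show "r = r'" using r by (simp add: cong_def)
  qed
  have img: "(\<lambda>r. (a * r) mod int N) ` ?R = ?R"
    by (rule endo_inj_surj[OF _ _ inj]) (use N in auto)
  have "(\<Sum>r\<in>?R. \<phi> r) = (\<Sum>r\<in>(\<lambda>r. (a * r) mod int N) ` ?R. \<phi> r)"
    using img by simp
  also have "\<dots> = (\<Sum>r\<in>?R. \<phi> ((a * r) mod int N))"
    by (simp add: sum.reindex[OF inj] o_def)
  also have "\<dots> = (\<Sum>r\<in>?R. \<phi> (a * r))"
    by (intro sum.cong refl dirichlet_character_cong[OF \<phi>]) simp
  also have "\<dots> = \<phi> a * (\<Sum>r\<in>?R. \<phi> r)" by (simp add: mult sum_distrib_left)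
  finally show ?thesis using a(2) by (metis mult_cancel_right1)
qed

text \<open>A full period sums to 0, so whole periods are stripped until fewer than \<open>N\<close>
  terms of norm at most 1 remain.\<close>

lemma norm_sum_dirichlet_character_le:
  assumes \<phi>: "dirichlet_character N \<phi>" and a: "coprime a (int N)" "\<phi> a \<noteq> 1"
  shows "norm (\<Sum>i=1..n. \<phi> (int i)) \<le> real N"
proof (induction n rule: less_induct)
  case (less n)
  have N: "N > 0" using \<phi> by (auto simp: dirichlet_character_def)
  show ?case
  proof (cases "n < N")
    case True
    have "norm (\<Sum>i=1..n. \<phi> (int i)) \<le> (\<Sum>i=1..n. 1)"
      by (intro sum_norm_le dirichlet_character_norm_le_1[OF \<phi>])
    then show ?thesis using True by simp
  next
    case False
    have "(\<Sum>i=1..n. \<phi> (int i)) = (\<Sum>i=1..N. \<phi> (int i)) + (\<Sum>i=1..n-N. \<phi> (int (i + N)))"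
    proof -
      have "{1..n} = {1..N} \<union> {1+N..(n-N)+N}" using False by auto
      then have "(\<Sum>i=1..n. \<phi> (int i)) = (\<Sum>i=1..N. \<phi> (int i)) + (\<Sum>i=1+N..(n-N)+N. \<phi> (int i))"
        by (simp only:) (subst sum.union_disjoint, auto)
      then show ?thesis by (simp only: sum.shift_bounds_cl_nat_ivl)
    qed
    also have "(\<Sum>i=1..n-N. \<phi> (int (i + N))) = (\<Sum>i=1..n-N. \<phi> (int i))"
      by (intro sum.cong refl dirichlet_character_cong[OF \<phi>]) (simp add: cong_def)
    also have "(\<Sum>i=1..N. \<phi> (int i)) = (\<Sum>i=0..<N. \<phi> (int (Suc i)))"
      by (rule sum.reindex_bij_witness[of _ Suc "\<lambda>i. i - 1"]) auto
    also have "\<dots> = (\<Sum>r\<in>{0..<int N}. \<phi> r)"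
    proof -
      \<comment> \<open>The period \<open>1..N\<close> is traded for the residues from 0 to
        \<open>N - 1\<close> by means of \<open>\<phi> N = \<phi> 0\<close>.\<close>
      have "(\<Sum>i=0..<N. \<phi> (int (Suc i))) + \<phi> (int 0) = (\<Sum>i=0..<Suc N. \<phi> (int i))"
        by (subst sum.atLeast0_lessThan_Suc_shift) (simp add: add.commute)
      also have "\<dots> = (\<Sum>i=0..<N. \<phi> (int i)) + \<phi> (int N)" by simp
      also have "\<phi> (int N) = \<phi> (int 0)"
        by (rule dirichlet_character_cong[OF \<phi>]) (simp add: cong_def)
      also have "(\<Sum>i=0..<N. \<phi> (int i)) = (\<Sum>r\<in>{0..<int N}. \<phi> r)"
        by (rule sum.reindex_bij_witness[of _ nat int]) auto
      finally show ?thesis by simp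
    qed
    also have "\<dots> = 0" by (rule sum_dirichlet_character_eq_0[OF \<phi> a])
    finally show ?thesis using less.IH[of "n - N"] N False by simp
  qed
qed

text \<open>Conjugation inverts values of norm 1, so this is the quotient of the two
  characters.\<close>

lemma dirichlet_character_mult_cnj:
  assumes "dirichlet_character N \<phi>" "dirichlet_character N' \<phi>'"
  shows "dirichlet_character (N * N') (\<lambda>a. \<phi> a * cnj (\<phi>' a))"
  unfolding dirichlet_character_def
proof (intro conjI allI)
  show "\<phi> (a + int (N * N')) * cnj (\<phi>' (a + int (N * N'))) = \<phi> a * cnj (\<phi>' a)" for a
  proof -
    have "\<phi> (a + int (N * N')) = \<phi> a"
      by (rule dirichlet_character_cong[OF assms(1)]) (simp add: cong_def)
    moreover have "\<phi>' (a + int (N * N')) = \<phi>' a"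
      by (rule dirichlet_character_cong[OF assms(2)]) (simp add: cong_def)
    ultimately show ?thesis by simp
  qed
qed (use assms in \<open>auto simp: dirichlet_character_def\<close>)

section \<open>Lifting residue classes, and uniqueness of primitive characters\<close>

text \<open>With \<open>t\<close> the product of the primes of \<open>M\<close> not dividing
  \<open>a\<close>, every prime of \<open>M\<close> divides exactly one of \<open>a\<close> and
  \<open>t * d\<close>.\<close>

lemma ex_coprime_shift:
  fixes a d M :: int
  assumes "coprime a d" and "M \<noteq> 0"
  shows "\<exists>t. coprime (a + t * d) M"
proof -
  let ?Q = "{p \<in> prime_factors M. \<not> p dvd a}"
  define t where "t = \<Prod>?Q"
  have fin: "finite ?Q" by simp
  have "coprime (a + t * d) M"
  proof (rule ccontr)
    assume "\<not> coprime (a + t * d) M"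
    then obtain c where c: "c dvd a + t * d" "c dvd M" "\<not> is_unit c" by (rule not_coprimeE)
    then have "c \<noteq> 0" using assms(2) by auto
    with c obtain p where p: "prime p" "p dvd c" using prime_divisor_exists by blast
    have pM: "p \<in> prime_factors M" using p c assms(2) by (auto simp: in_prime_factors_iff)
    have dvd: "p dvd a + t * d" using p c by auto
    show False
    proof (cases "p dvd a")
      case True
      then have "p dvd t * d" using dvd by (simp add: dvd_add_right_iff)
      moreover have "\<not> p dvd d" using True assms(1) p(1)
        by (meson coprime_common_divisor not_prime_unit)
      ultimately have "p dvd t" using p(1) by (simp add: prime_dvd_mult_iff)
      then obtain q where q: "q \<in> ?Q" "p dvd q" unfolding t_def
        using prime_dvd_prod_iff[OF fin p(1)] by auto
      then have "p = q" using p(1) primes_dvd_imp_eq by auto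
      then show False using q True by auto
    next
      case False
      then have "p dvd t" unfolding t_def using fin pM by (intro dvd_prodI) auto
      then show False using dvd False by (simp add: dvd_add_left_iff)
    qed
  qed
  then show ?thesis by blast
qed

text \<open>Chinese remainder theorem for moduli that may share factors: Bezout writes
  \<open>v - u\<close> as \<open>k * (x * m + y * n)\<close>, and \<open>u + k * x * m\<close> is
  the witness.\<close>

lemma ex_simultaneous_cong:
  fixes u v m n :: int
  assumes "[u = v] (mod gcd m n)"
  shows "\<exists>c. [c = u] (mod m) \<and> [c = v] (mod n)"
proof -
  obtain k where k: "v = u + gcd m n * k" using assms cong_iff_lin by blast
  obtain x y where xy: "x * m + y * n = gcd m n" using bezout_int by blast
  have "u + k * x * m = v - k * y * n"
    unfolding k xy[symmetric] by (simp add: algebra_simps)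
  moreover have "[u + k * x * m = u] (mod m)" "[v - k * y * n = v] (mod n)"
    by (simp_all add: cong_iff_dvd_diff)
  ultimately show ?thesis by metis
qed

text \<open>By the Chinese remainder theorem, \<open>\<phi>\<close> depends only on the residue modulo \<open>gcd N N'\<close>, hence is
  induced from a character with that modulus.\<close>

lemma primitive_character_dvd:
  assumes prim: "primitive_character N \<phi>" and dir': "dirichlet_character N' \<phi>'"
    and eq: "\<And>a. coprime a (int (N * N')) \<Longrightarrow> \<phi> a = \<phi>' a"
  shows "N dvd N'"
proof -
  define d where "d = gcd N N'"
  let ?M = "int (N * N')"
  have dir: "dirichlet_character N \<phi>" using prim by (simp add: primitive_character_def)
  have N: "N > 0" "N' > 0" using dir dir' by (auto simp: dirichlet_character_def)
  have mult: "\<phi> (a * b) = \<phi> a * \<phi> b" and ne0: "\<phi> a \<noteq> 0 \<longleftrightarrow> coprime a (int N)" for a b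
    using dir by (auto simp: dirichlet_character_def)
  have dN: "int d dvd int N" "int d dvd int N'" by (auto simp: d_def)
  \<comment> \<open>An integer \<open>c\<close> congruent to \<open>a\<close> modulo
    \<open>N\<close> and to \<open>b\<close> modulo \<open>N'\<close> links the values:
    \<open>\<phi>\<close> passes from \<open>a\<close> to \<open>c\<close>, there it equals
    \<open>\<phi>'\<close>, which passes from \<open>c\<close> to \<open>b\<close>.\<close>
  have wd: "\<phi> a = \<phi> b" if "coprime a ?M" "coprime b ?M" "[a = b] (mod int d)" for a b
  proof -
    have "[a = b] (mod gcd (int N) (int N'))" using that by (simp add: d_def)
    then obtain c where c: "[c = a] (mod int N)" "[c = b] (mod int N')"
      using ex_simultaneous_cong by blast
    have "coprime c (int N)"
      using c(1) that(1) by (metis cong_imp_coprime cong_sym coprime_mult_right_iff of_nat_mult)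
    moreover have "coprime c (int N')"
      using c(2) that(2) by (metis cong_imp_coprime cong_sym coprime_mult_right_iff of_nat_mult)
    ultimately have "coprime c ?M" by simp
    have "\<phi> a = \<phi> c" using dirichlet_character_cong[OF dir c(1)] by simp
    also have "\<dots> = \<phi>' c" by (rule eq) fact
    also have "\<dots> = \<phi>' b" by (rule dirichlet_character_cong[OF dir' c(2)])
    also have "\<dots> = \<phi> b" using eq that by simp
    finally show ?thesis .
  qed
  \<comment> \<open>The two characters are comparable only at integers coprime to
    \<open>N * N'\<close>; this supplies such representatives, for \<open>e = d\<close> and for
    \<open>e = N\<close>.\<close>
  have lift: "\<exists>b. coprime b ?M \<and> [b = a] (mod int e)" if "coprime a (int e)" for a e
  proof -
    from ex_coprime_shift[OF that, of ?M] N
    obtain t where "coprime (a + t * int e) ?M" by auto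
    moreover have "[a + t * int e = a] (mod int e)" by (simp add: cong_def)
    ultimately show ?thesis by blast
  qed
  define h where "h a = (SOME b. coprime b ?M \<and> [b = a] (mod int d))" for a
  have h: "coprime (h a) ?M" "[h a = a] (mod int d)" if "coprime a (int d)" for a
    using someI_ex[OF lift[OF that]] unfolding h_def by auto
  define \<psi> where "\<psi> a = (if coprime a (int d) then \<phi> (h a) else 0)" for a
  have cop_cong: "coprime a (int d) \<longleftrightarrow> coprime b (int d)" if "[a = b] (mod int d)" for a b
    using that cong_imp_coprime cong_sym by blast
  have "dirichlet_character d \<psi>"
    unfolding dirichlet_character_def
  proof (intro conjI allI)
    show "d > 0" using N by (simp add: d_def)
    show "\<psi> (a * b) = \<psi> a * \<psi> b" for a b
    proof (cases "coprime a (int d) \<and> coprime b (int d)")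
      case True
      then have ab: "coprime (a * b) (int d)" by simp
      have "\<phi> (h (a * b)) = \<phi> (h a * h b)"
      proof (rule wd)
        show "[h (a * b) = h a * h b] (mod int d)"
          using h(2)[OF ab] cong_mult[OF h(2) h(2)] True cong_sym cong_trans by blast
      qed (use h(1) True ab in auto)
      then show ?thesis using True ab by (simp add: \<psi>_def mult)
    qed (auto simp: \<psi>_def)
    show "\<psi> (a + int d) = \<psi> a" for a
    proof -
      have c: "[a + int d = a] (mod int d)" by (simp add: cong_def)
      show ?thesis
      proof (cases "coprime a (int d)")
        case True
        then have "coprime (a + int d) (int d)" using cop_cong[OF c] by simp
        moreover from this have "\<phi> (h (a + int d)) = \<phi> (h a)"
          using True h c by (intro wd) (blast intro: cong_sym cong_trans)+
        ultimately show ?thesis using True by (simp add: \<psi>_def)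
      qed (use cop_cong[OF c] in \<open>simp add: \<psi>_def\<close>)
    qed
    show "\<psi> a \<noteq> 0 \<longleftrightarrow> coprime a (int d)" for a
      using h(1)[of a] ne0[of "h a"] by (auto simp: \<psi>_def)
  qed
  moreover have "\<phi> a = \<psi> a" if a: "coprime a (int N)" for a
  proof -
    \<comment> \<open>\<open>a\<close> may share a factor with \<open>N'\<close>, so it is first
      moved within its class modulo \<open>N\<close>.\<close>
    obtain b where b: "coprime b ?M" "[b = a] (mod int N)" using lift[OF a] by blast
    have ad: "coprime a (int d)" using a dN(1) by (meson coprime_divisors dvd_refl)
    have "\<phi> a = \<phi> b" using dirichlet_character_cong[OF dir b(2)] by simp
    also have "\<dots> = \<phi> (h a)"
    proof (rule wd[OF b(1) h(1)[OF ad]])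
      show "[b = h a] (mod int d)"
        using b(2) dN(1) h(2)[OF ad] by (meson cong_dvd_modulus cong_sym cong_trans)
    qed
    finally show ?thesis using ad by (simp add: \<psi>_def)
  qed
  ultimately have "\<not> (d dvd N \<and> d < N)" using prim unfolding primitive_character_def by blast
  moreover have "d dvd N" by (simp add: d_def)
  ultimately have "d = N" using N dvd_imp_le le_neq_implies_less by blast
  then show ?thesis by (metis d_def gcd_dvd2)
qed

text \<open>The moduli divide each other by symmetry; with a common modulus both characters vanish
  at the same integers.\<close>

lemma primitive_character_unique:
  assumes prim: "primitive_character N \<phi>" "primitive_character N' \<phi>'"
    and eq: "\<And>a. coprime a (int (N * N')) \<Longrightarrow> \<phi> a = \<phi>' a"
  shows "N = N' \<and> \<phi> = \<phi>'"
proof -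
  have dir: "dirichlet_character N \<phi>" "dirichlet_character N' \<phi>'"
    using prim by (auto simp: primitive_character_def)
  have "N dvd N'" using prim(1) dir(2) eq by (rule primitive_character_dvd)
  moreover have "N' dvd N"
    by (rule primitive_character_dvd[OF prim(2) dir(1)]) (metis eq mult.commute)
  ultimately have N: "N = N'" by (rule dvd_antisym)
  have "\<phi> a = \<phi>' a" for a
  proof (cases "coprime a (int N)")
    case True
    then show ?thesis using eq N by simp
  next
    case False
    then show ?thesis using dir N by (metis dirichlet_character_def)
  qed
  then show ?thesis using N by blast
qed

text \<open>If the characters differ at some \<open>a\<close> coprime to both moduli, their quotient
  is non-principal, hence has bounded partial sums, yet is 1 at all large primes of
  \<open>S\<close>.\<close>

lemma primitive_characters_eq_of_density:
  assumes prim: "primitive_character N \<phi>" "primitive_character N' \<phi>'"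
    and S: "\<And>p. p \<in> S \<Longrightarrow> prime p"
    and c: "c > 1 / 2"
    and D: "\<And>n. c * real (card {p. prime p \<and> p \<le> n}) - C \<le> real (card {p \<in> S. p \<le> n})"
    and eq: "\<And>p. p \<in> S \<Longrightarrow> p \<ge> p0 \<Longrightarrow> \<phi> (int p) = \<phi>' (int p)"
  shows "N = N' \<and> \<phi> = \<phi>'"
proof (rule primitive_character_unique[OF prim], rule ccontr)
  fix a assume a: "coprime a (int (N * N'))" "\<phi> a \<noteq> \<phi>' a"
  define \<psi> where "\<psi> = (\<lambda>a. \<phi> a * cnj (\<phi>' a))"
  have dir: "dirichlet_character N \<phi>" "dirichlet_character N' \<phi>'"
    using prim by (auto simp: primitive_character_def)
  have N: "N > 0" "N' > 0" using dir by (auto simp: dirichlet_character_def)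
  have \<psi>: "dirichlet_character (N * N') \<psi>"
    unfolding \<psi>_def by (rule dirichlet_character_mult_cnj[OF dir])
  have unit: "\<phi>' b * cnj (\<phi>' b) = 1" if "coprime b (int N')" for b
    using dirichlet_character_norm_eq_1[OF dir(2) that] by (simp add: complex_norm_square[symmetric])
  have "\<psi> a \<noteq> 1"
  proof
    assume "\<psi> a = 1"
    have "\<phi> a = \<phi> a * (\<phi>' a * cnj (\<phi>' a))" using unit[of a] a(1) by simp
    also have "\<dots> = \<phi>' a * \<psi> a" unfolding \<psi>_def by (rule mult.left_commute)
    finally show False using \<open>\<psi> a = 1\<close> a(2) by simp
  qed
  have bound: "norm (\<Sum>i=1..n. \<psi> (int i)) \<le> real (N * N')" for n
    by (rule norm_sum_dirichlet_character_le[OF \<psi> a(1)]) fact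
  \<comment> \<open>Primes beyond \<open>N * N'\<close> do not divide \<open>N'\<close>, so
    \<open>\<phi>'\<close> has norm 1 there and agreement makes the quotient 1.\<close>
  show False
  proof (rule character_eq_one_density[where \<psi> = "\<lambda>n. \<psi> (int n)" and ?p0.0 = "max p0 (Suc (N * N'))"])
    show "\<psi> (int (m * n)) = \<psi> (int m) * \<psi> (int n)" for m n
      using \<psi> by (simp add: dirichlet_character_def)
    show "\<psi> (int 1) = 1" using dirichlet_character_one[OF \<psi>] by simp
    show "norm (\<psi> (int n)) \<le> 1" for n by (rule dirichlet_character_norm_le_1[OF \<psi>])
    show "\<psi> (int p) = 1" if p: "p \<in> S" "max p0 (Suc (N * N')) \<le> p" for p
    proof -
      have "N' \<le> N * N'" using N by simp
      also have "\<dots> < p" using p(2) by simp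
      finally have "\<not> p dvd N'" using N by (auto dest!: dvd_imp_le)
      then have "coprime p N'" using S[OF p(1)] prime_imp_coprime by blast
      then show ?thesis using eq[OF p(1)] p unit[of "int p"] by (simp add: \<psi>_def)
    qed
  qed (use bound S c D in auto)
qed

section \<open>Coefficients of Eisenstein newforms\<close>

text \<open>The hypothesis leaves out the centre because \<open>q_nome\<close> never vanishes; the
  constant term is therefore recovered as a limit.\<close>

lemma power_series_coeffs_eq:
  fixes a b :: "nat \<Rightarrow> complex"
  assumes "\<And>w. w \<noteq> 0 \<Longrightarrow> norm w < 1 \<Longrightarrow> \<exists>l. (\<lambda>n. a n * w ^ n) sums l \<and> (\<lambda>n. b n * w ^ n) sums l"
  shows "a = b"
proof -
  define d where "d n = a n - b n" for n
  have d: "(\<lambda>n. d n * w ^ n) sums 0" if "w \<noteq> 0" "norm w < 1" for w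
  proof -
    from assms[OF that] obtain l
      where "(\<lambda>n. a n * w ^ n) sums l" "(\<lambda>n. b n * w ^ n) sums l" by blast
    from sums_diff[OF this] show ?thesis by (simp add: d_def left_diff_distrib)
  qed
  have "((\<lambda>_. 0) \<longlongrightarrow> d 0) (at (0::complex))"
    by (rule powser_limit_0_strong[of 1]) (use d in auto)
  then have d0: "d 0 = 0" by (metis at_neq_bot tendsto_const_iff)
  \<comment> \<open>A nonzero coefficient of positive index would make 0 an isolated zero of the
    sum, which is identically 0.\<close>
  have dm: "d m = 0" if "m > 0" for m
  proof (rule ccontr)
    assume m: "d m \<noteq> 0"
    have hs: "(\<lambda>n. d n * (x - 0) ^ n) sums 0" if "norm (x - 0) < 1" for x
      using d[of x] that d0 powser_sums_zero[of d] by (cases "x = 0") auto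
    show False
    proof (rule powser_0_nonzero[where a = d and \<xi> = 0 and f = "\<lambda>_. 0" and m = m,
          OF zero_less_one hs refl m that])
      fix s :: real assume s: "0 < s" "\<And>z::complex. z \<in> cball 0 s - {0} \<Longrightarrow> (0::complex) \<noteq> 0"
      show False using s(2)[of "of_real s"] s(1) by auto
    qed
  qed
  have "d n = 0" for n using d0 dm by (cases n) auto
  then show ?thesis by (auto simp: d_def)
qed

text \<open>The preimage is \<open>Ln w\<close> divided by \<open>2 * pi * \<i>\<close>; its
  imaginary part is positive exactly because \<open>ln |w|\<close> is negative.\<close>

lemma ex_q_nome_eq:
  assumes "w \<noteq> 0" "norm w < 1"
  shows "\<exists>z\<in>upper_half_plane. q_nome z = w"
proof -
  define z where "z = - \<i> * Ln w / (2 * of_real pi)"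
  have "Re (Ln w) < 0" using assms by simp
  then have "z \<in> upper_half_plane"
    by (simp add: z_def upper_half_plane_def field_simps)
  moreover have "2 * of_real pi * \<i> * z = Ln w"
    by (simp add: z_def field_simps)
  then have "q_nome z = w" using assms(1) by (simp add: q_nome_def)
  ultimately show ?thesis by blast
qed

lemma norm_q_nome_less_1: "z \<in> upper_half_plane \<Longrightarrow> norm (q_nome z) < 1"
  by (simp add: upper_half_plane_def q_nome_def)

lemma fourier_coeff_eqI:
  assumes "\<And>z. z \<in> upper_half_plane \<Longrightarrow> (\<lambda>n. a n * q_nome z ^ n) sums f z"
  shows "fourier_coeff f = a"
  unfolding fourier_coeff_def
proof (rule the_equality)
  fix b assume b: "\<forall>z\<in>upper_half_plane. (\<lambda>n. b n * q_nome z ^ n) sums f z"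
  show "b = a"
  proof (rule power_series_coeffs_eq)
    fix w :: complex assume "w \<noteq> 0" "norm w < 1"
    then obtain z where "z \<in> upper_half_plane" "q_nome z = w" using ex_q_nome_eq by blast
    then show "\<exists>l. (\<lambda>n. b n * w ^ n) sums l \<and> (\<lambda>n. a n * w ^ n) sums l"
      using assms[of z] b by auto
  qed
qed (use assms in blast)

text \<open>Ratio test: the quotients tend to \<open>r\<close>, so they fall below
  \<open>(1 + r) / 2\<close>, the midpoint of \<open>r\<close> and 1.\<close>

lemma summable_power_mult_geometric:
  fixes r :: real
  assumes r: "0 \<le> r" "r < 1"
  shows "summable (\<lambda>n. real n ^ j * r ^ n)"
proof -
  have "(\<lambda>n. (real (Suc n) / real n) ^ j * r) \<longlonglongrightarrow> 1 ^ j * r"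
    using LIMSEQ_Suc_n_over_n by (intro tendsto_intros)
  then have "eventually (\<lambda>n. (real (Suc n) / real n) ^ j * r < (1 + r) / 2) sequentially"
    by (rule order_tendstoD) (use r in simp)
  then obtain M where M: "\<And>n. n \<ge> M \<Longrightarrow> (real (Suc n) / real n) ^ j * r < (1 + r) / 2"
    by (auto simp: eventually_sequentially)
  show ?thesis
  proof (rule summable_ratio_test)
    show "(1 + r) / 2 < 1" using r by simp
    \<comment> \<open>Starting at \<open>Suc M\<close> makes \<open>n\<close> nonzero, so the
      quotient by \<open>n\<close> cancels.\<close>
    fix n assume n: "n \<ge> Suc M"
    have "real (Suc n) ^ j * r ^ Suc n = ((real (Suc n) / real n) ^ j * r) * (real n ^ j * r ^ n)"
      using n by (simp add: power_divide)
    also have "\<dots> \<le> (1 + r) / 2 * (real n ^ j * r ^ n)"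
      using M[of n] n r by (intro mult_right_mono) auto
    finally show "norm (real (Suc n) ^ j * r ^ Suc n) \<le> (1 + r) / 2 * norm (real n ^ j * r ^ n)"
      using r by simp
  qed
qed

text \<open>There are at most \<open>n\<close> divisors; a polynomial bound is enough for
  convergence inside the unit disc.\<close>

lemma norm_twisted_sigma_le:
  assumes "\<And>a. norm (\<chi>1 a) \<le> 1" "\<And>a. norm (\<chi>2 a) \<le> 1" and n: "n > 0"
  shows "norm (twisted_sigma \<chi>1 \<chi>2 m n) \<le> real n ^ Suc m"
proof -
  have "norm (twisted_sigma \<chi>1 \<chi>2 m n) \<le> (\<Sum>d | d dvd n. real n ^ m)"
    unfolding twisted_sigma_def
  proof (rule sum_norm_le)
    fix d assume "d \<in> {d. d dvd n}"
    then have "d \<le> n" using n by (auto dest: dvd_imp_le)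
    have "norm (\<chi>1 (int (n div d)) * \<chi>2 (int d) * of_nat d ^ m) \<le> 1 * 1 * real d ^ m"
      unfolding norm_mult norm_power by (intro mult_mono assms) auto
    also have "\<dots> \<le> real n ^ m" using \<open>d \<le> n\<close> by (simp add: power_mono)
    finally show "norm (\<chi>1 (int (n div d)) * \<chi>2 (int d) * of_nat d ^ m) \<le> real n ^ m" .
  qed
  also have "\<dots> = real (card {d. d dvd n}) * real n ^ m" by simp
  also have "\<dots> \<le> real n * real n ^ m"
  proof -
    have "{d. d dvd n} \<subseteq> {1..n}" using n by (auto dest: dvd_imp_le simp: Suc_le_eq intro!: Nat.gr0I)
    then have "card {d. d dvd n} \<le> card {1..n}" by (rule card_mono[rotated]) simp
    then show ?thesis by (intro mult_right_mono) auto
  qed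
  finally show ?thesis by simp
qed

text \<open>The defining series converges absolutely on the upper half-plane and so is the expansion
  in \<open>q\<close>; the L-value sits at index 0.\<close>

lemma fourier_coeff_eisenstein:
  assumes "\<And>a. norm (\<chi>1 a) \<le> 1" "\<And>a. norm (\<chi>2 a) \<le> 1"
    and f: "\<And>z. z \<in> upper_half_plane \<Longrightarrow> f z = eisenstein_E N1 \<chi>1 \<chi>2 k z"
    and n: "n > 0"
  shows "fourier_coeff f n = twisted_sigma \<chi>1 \<chi>2 (k - 1) n"
proof -
  define c where "c = (if principal_character N1 \<chi>1 then 1 else 0) / 2 * dirichlet_L \<chi>2 (1 - of_nat k)"
  define a where "a n = (if n = 0 then c else twisted_sigma \<chi>1 \<chi>2 (k - 1) n)" for n
  have "fourier_coeff f = a"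
  proof (rule fourier_coeff_eqI)
    fix z assume z: "z \<in> upper_half_plane"
    let ?q = "q_nome z"
    let ?t = "\<lambda>n. twisted_sigma \<chi>1 \<chi>2 (k - 1) (Suc n) * ?q ^ Suc n"
    have "summable (\<lambda>n. real (Suc n) ^ Suc (k - 1) * norm ?q ^ Suc n)"
      using summable_power_mult_geometric[of "norm ?q" "Suc (k - 1)"] norm_q_nome_less_1[OF z]
      by (subst summable_Suc_iff) simp
    moreover have "norm (?t n) \<le> real (Suc n) ^ Suc (k - 1) * norm ?q ^ Suc n" for n
      unfolding norm_mult norm_power
      by (intro mult_right_mono norm_twisted_sigma_le assms) auto
    ultimately have "summable ?t" by (rule summable_comparison_test'[where N = 0])
    then have "(\<lambda>n. a (Suc n) * ?q ^ Suc n) sums (\<Sum>n. ?t n)"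
      by (simp add: a_def summable_sums)
    then have "(\<lambda>n. a n * ?q ^ n) sums ((\<Sum>n. ?t n) + a 0 * ?q ^ 0)"
      by (rule sums_Suc)
    then show "(\<lambda>n. a n * ?q ^ n) sums f z"
      using f[OF z] by (simp add: eisenstein_E_def a_def c_def add.commute)
  qed
  then show ?thesis using n by (simp add: a_def)
qed

lemma twisted_sigma_prime:
  assumes "prime p" "\<chi>1 1 = 1" "\<chi>2 1 = 1"
  shows "twisted_sigma \<chi>1 \<chi>2 m p = \<chi>1 (int p) + \<chi>2 (int p) * of_nat p ^ m"
proof -
  have "{d. d dvd p} = {1, p}" using assms(1) by (auto simp: prime_nat_iff)
  moreover have "p \<noteq> 1" "p \<noteq> 0" using assms(1) by auto
  ultimately show ?thesis using assms by (simp add: twisted_sigma_def)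
qed

section \<open>Consequences of density, and growth of coefficients at primes\<close>

text \<open>The limit gives the bound for large \<open>n\<close>; the constant absorbs the finitely
  many others. An inequality for every \<open>n\<close> is what summation by parts consumes.\<close>

lemma has_prime_density_lower_bound:
  assumes "has_prime_density S \<delta>" "c < \<delta>" "c > 0"
  shows "\<exists>C. \<forall>n. c * real (card {p. prime p \<and> p \<le> n}) - C \<le> real (card {p \<in> S. p \<le> n})"
proof -
  have "eventually (\<lambda>x. c < real (card {p \<in> S. real p \<le> x}) / real (card {p. prime p \<and> real p \<le> x})) at_top"
    using assms(1,2) unfolding has_prime_density_def by (rule order_tendstoD)
  then obtain X where X: "\<And>x. x \<ge> X \<Longrightarrow>
      c < real (card {p \<in> S. real p \<le> x}) / real (card {p. prime p \<and> real p \<le> x})"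
    by (auto simp: eventually_at_top_linorder)
  define m where "m = nat \<lceil>X\<rceil>"
  have "c * real (card {p. prime p \<and> p \<le> n}) - c * real m \<le> real (card {p \<in> S. p \<le> n})" for n
  proof (cases "n \<ge> m")
    case True
    then have "real n \<ge> X" unfolding m_def by linarith
    from X[OF this] have lt: "c < real (card {p \<in> S. p \<le> n}) / real (card {p. prime p \<and> p \<le> n})"
      by simp
    \<comment> \<open>Division by zero yields 0, which \<open>c > 0\<close> rules out.\<close>
    then have "card {p. prime p \<and> p \<le> n} \<noteq> 0" using assms(3) by (intro notI) simp
    then have "0 < real (card {p. prime p \<and> p \<le> n})" by linarith
    with lt have "c * real (card {p. prime p \<and> p \<le> n}) < real (card {p \<in> S. p \<le> n})"
      by (simp only: pos_less_divide_eq)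
    moreover have "0 \<le> c * real m" using assms(3) by simp
    ultimately show ?thesis by linarith
  next
    case False
    have "{p. prime p \<and> p \<le> n} \<subseteq> {1..n}" by (auto simp: Suc_le_eq prime_gt_0_nat)
    then have "card {p. prime p \<and> p \<le> n} \<le> card {1..n}" by (rule card_mono[rotated]) simp
    then have "card {p. prime p \<and> p \<le> n} \<le> m" using False by simp
    then have "c * real (card {p. prime p \<and> p \<le> n}) \<le> c * real m" using assms(3) by simp
    then show ?thesis by linarith
  qed
  then show ?thesis by blast
qed

lemma infinite_of_prime_density:
  fixes S :: "nat set"
  assumes D: "\<And>n. c * real (card {p. prime p \<and> p \<le> n}) - C \<le> real (card {p \<in> S. p \<le> n})"
    and c: "c > 0"
  shows "infinite S"
proof
  assume fin: "finite S"
  \<comment> \<open>The size is chosen so that \<open>c * card T\<close> exceeds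
    \<open>card S + C\<close>.\<close>
  obtain T :: "nat set" where T: "finite T" "card T = Suc (nat \<lceil>(card S + C) / c\<rceil>)" "T \<subseteq> Collect prime"
    using infinite_arbitrarily_large[OF primes_infinite] by blast
  define n where "n = Max T"
  have "T \<subseteq> {p. prime p \<and> p \<le> n}" using T by (auto simp: n_def)
  then have "card T \<le> card {p. prime p \<and> p \<le> n}" by (intro card_mono) auto
  moreover have "real (card T) > (card S + C) / c" unfolding T(2) by linarith
  ultimately have "real (card {p. prime p \<and> p \<le> n}) > (card S + C) / c" by linarith
  then have "c * real (card {p. prime p \<and> p \<le> n}) > card S + C"
    using c by (simp add: pos_divide_less_eq mult.commute)
  moreover have "card {p \<in> S. p \<le> n} \<le> card S" using fin by (intro card_mono) auto
  ultimately show False using D[of n] by linarith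
qed

text \<open>By periodicity modulo \<open>N * N'\<close> the difference takes finitely many values,
  so its nonzero norms have a positive minimum.\<close>

lemma dirichlet_characters_gap:
  assumes "dirichlet_character N \<phi>" "dirichlet_character N' \<phi>'"
  shows "\<exists>\<epsilon>>0. \<forall>a. \<phi> a \<noteq> \<phi>' a \<longrightarrow> \<epsilon> \<le> norm (\<phi> a - \<phi>' a)"
proof -
  let ?M = "int (N * N')"
  define v where "v a = norm (\<phi> a - \<phi>' a)" for a
  \<comment> \<open>Inserting 1 keeps the set nonempty when the characters coincide.\<close>
  define V where "V = insert 1 (v ` {0..<?M} - {0})"
  have M: "?M > 0" using assms by (auto simp: dirichlet_character_def)
  have fin: "finite V" by (simp add: V_def)
  have "Min V > 0" using fin by (subst Min_gr_iff) (auto simp: V_def v_def)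
  moreover have "Min V \<le> norm (\<phi> a - \<phi>' a)" if "\<phi> a \<noteq> \<phi>' a" for a
  proof -
    have M': "[a mod ?M = a] (mod ?M)" by simp
    have c: "[a mod ?M = a] (mod int N)" "[a mod ?M = a] (mod int N')"
      by (rule cong_dvd_modulus[OF M'], simp)+
    have "v (a mod ?M) = v a" unfolding v_def
      using dirichlet_character_cong[OF assms(1) c(1)] dirichlet_character_cong[OF assms(2) c(2)] by simp
    moreover have "a mod ?M \<in> {0..<?M}" using M by simp
    ultimately have "v a \<in> v ` {0..<?M}" by (metis imageI)
    then have "v a \<in> V" using that by (auto simp: V_def v_def)
    then show ?thesis using fin by (simp add: v_def)
  qed
  ultimately show ?thesis by blast
qed

text \<open>At a large prime the term with \<open>\<eta>2\<close> has norm \<open>p ^ m'\<close>,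
  while the remaining terms add up to at most \<open>p ^ m + 2\<close>.\<close>

lemma prime_coeff_weight_le:
  assumes "infinite S" and S: "\<And>p. p \<in> S \<Longrightarrow> prime p"
    and le1: "\<And>a. norm (\<chi>1 a) \<le> 1" "\<And>a. norm (\<chi>2 a) \<le> 1" "\<And>a. norm (\<eta>1 a) \<le> 1"
    and \<eta>2: "dirichlet_character M \<eta>2"
    and eq: "\<And>p. p \<in> S \<Longrightarrow> \<chi>1 (int p) + \<chi>2 (int p) * of_nat p ^ m = \<eta>1 (int p) + \<eta>2 (int p) * of_nat p ^ m'"
  shows "m' \<le> m"
proof (rule ccontr)
  assume m: "\<not> m' \<le> m"
  have M: "M > 0" using \<eta>2 by (simp add: dirichlet_character_def)
  \<comment> \<open>Beyond \<open>M\<close> the prime is coprime to \<open>M\<close>; beyond 3 it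
    gives \<open>4 * p ^ m \<le> p ^ m'\<close>, too large for \<open>2 + p ^ m\<close>.\<close>
  obtain p where p: "p \<in> S" "p > max M 3"
    using \<open>infinite S\<close> infinite_nat_iff_unbounded by blast
  have "\<not> p dvd M" using p M by (auto dest!: dvd_imp_le)
  then have "coprime p M" using S[OF p(1)] prime_imp_coprime by blast
  then have "norm (\<eta>2 (int p)) = 1" by (intro dirichlet_character_norm_eq_1[OF \<eta>2]) simp
  then have "real p ^ m' = norm (\<eta>2 (int p) * of_nat p ^ m')"
    by (simp add: norm_mult norm_power)
  also have "\<eta>2 (int p) * of_nat p ^ m' = \<chi>1 (int p) + \<chi>2 (int p) * of_nat p ^ m - \<eta>1 (int p)"
    using eq[OF p(1)] by (simp add: algebra_simps)
  also have "norm \<dots> \<le> norm (\<chi>1 (int p)) + norm (\<chi>2 (int p) * of_nat p ^ m) + norm (\<eta>1 (int p))"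
    using norm_triangle_ineq4 norm_triangle_ineq by (meson add_right_mono order_trans)
  also have "\<dots> \<le> 1 + 1 * real p ^ m + 1"
    unfolding norm_mult norm_power by (intro add_mono mult_mono le1) auto
  finally have "real p ^ m' \<le> 2 + real p ^ m" by simp
  moreover have "real p ^ Suc m \<le> real p ^ m'" using m p by (intro power_increasing) auto
  moreover have "4 * real p ^ m \<le> real p ^ Suc m"
    using p by (simp add: mult_right_mono)
  moreover have "1 \<le> real p ^ m" using p by (intro one_le_power) auto
  ultimately show False by linarith
qed

theorem theorem5p1:
  fixes f g :: "complex \<Rightarrow> complex"
    and k k' N N' :: nat
    and \<chi>f \<chi>g :: "int \<Rightarrow> complex"
    and S :: "nat set"
    and \<delta> :: real
  assumes "eisenstein_newform k N \<chi>f f"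
    and "eisenstein_newform k' N' \<chi>g g"
    and "\<And>p. p \<in> S \<Longrightarrow> prime p"
    and "has_prime_density S \<delta>" and "\<delta> > 1 / 2"
    and "\<And>p. p \<in> S \<Longrightarrow> fourier_coeff f p = fourier_coeff g p"
  shows "k = k' \<and> N = N' \<and> \<chi>f = \<chi>g \<and> (\<forall>z\<in>upper_half_plane. f z = g z)"
proof -
  obtain N1 N2 \<chi>1 \<chi>2 where k: "k \<ge> 2"
    and \<chi>: "primitive_character N1 \<chi>1" "primitive_character N2 \<chi>2"
    and N: "N = N1 * N2" and \<chi>f: "\<chi>f = (\<lambda>a. \<chi>1 a * \<chi>2 a)"
    and f: "\<And>z. z \<in> upper_half_plane \<Longrightarrow> f z = eisenstein_E N1 \<chi>1 \<chi>2 k z"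
    using assms(1) unfolding eisenstein_newform_def by blast
  obtain M1 M2 \<eta>1 \<eta>2 where k': "k' \<ge> 2"
    and \<eta>: "primitive_character M1 \<eta>1" "primitive_character M2 \<eta>2"
    and N': "N' = M1 * M2" and \<chi>g: "\<chi>g = (\<lambda>a. \<eta>1 a * \<eta>2 a)"
    and g: "\<And>z. z \<in> upper_half_plane \<Longrightarrow> g z = eisenstein_E M1 \<eta>1 \<eta>2 k' z"
    using assms(2) unfolding eisenstein_newform_def by blast
  have dir: "dirichlet_character N1 \<chi>1" "dirichlet_character N2 \<chi>2"
      "dirichlet_character M1 \<eta>1" "dirichlet_character M2 \<eta>2"
    using \<chi> \<eta> by (auto simp: primitive_character_def)
  note le1 = dir[THEN dirichlet_character_norm_le_1]
  note one = dir[THEN dirichlet_character_one]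
  \<comment> \<open>The midpoint of \<open>1 / 2\<close> and \<open>\<delta>\<close>: below the
    density, so the counting bound holds, and still above \<open>1 / 2\<close>.\<close>
  define c where "c = (\<delta> + 1 / 2) / 2"
  have c: "1 / 2 < c" "c < \<delta>" "c > 0" using assms(5) by (auto simp: c_def)
  obtain C where D: "\<And>n. c * real (card {p. prime p \<and> p \<le> n}) - C \<le> real (card {p \<in> S. p \<le> n})"
    using has_prime_density_lower_bound[OF assms(4) c(2,3)] by blast
  have inf: "infinite S" using D c(3) by (rule infinite_of_prime_density)
  have coeff: "\<chi>1 (int p) + \<chi>2 (int p) * of_nat p ^ (k - 1) = \<eta>1 (int p) + \<eta>2 (int p) * of_nat p ^ (k' - 1)"
    if p: "p \<in> S" for p
  proof -
    have pr: "prime p" using assms(3) p by blast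
    have "fourier_coeff f p = \<chi>1 (int p) + \<chi>2 (int p) * of_nat p ^ (k - 1)"
      using fourier_coeff_eisenstein[where ?\<chi>1.0 = \<chi>1 and ?\<chi>2.0 = \<chi>2, OF le1(1,2) f]
        twisted_sigma_prime[of p \<chi>1 \<chi>2, OF pr one(1,2)] prime_gt_0_nat[OF pr]
      by simp
    moreover have "fourier_coeff g p = \<eta>1 (int p) + \<eta>2 (int p) * of_nat p ^ (k' - 1)"
      using fourier_coeff_eisenstein[where ?\<chi>1.0 = \<eta>1 and ?\<chi>2.0 = \<eta>2, OF le1(3,4) g]
        twisted_sigma_prime[of p \<eta>1 \<eta>2, OF pr one(3,4)] prime_gt_0_nat[OF pr]
      by simp
    ultimately show ?thesis using assms(6)[OF p] by simp
  qed
  have "k' - 1 \<le> k - 1"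
    by (rule prime_coeff_weight_le[where ?\<chi>1.0 = \<chi>1 and ?\<chi>2.0 = \<chi>2 and ?\<eta>1.0 = \<eta>1 and ?\<eta>2.0 = \<eta>2,
          OF inf assms(3) le1(1,2,3) dir(4) coeff])
  moreover have "k - 1 \<le> k' - 1"
    by (rule prime_coeff_weight_le[where ?\<chi>1.0 = \<eta>1 and ?\<chi>2.0 = \<eta>2 and ?\<eta>1.0 = \<chi>1 and ?\<eta>2.0 = \<chi>2,
          OF inf assms(3) le1(3,4,1) dir(2) coeff[symmetric]])
  \<comment> \<open>Subtraction on naturals truncates; weights of at least 2 make the equality of
    \<open>k - 1\<close> and \<open>k' - 1\<close> conclusive.\<close>
  ultimately have kk: "k = k'" using k k' by linarith
  obtain \<epsilon> where \<epsilon>: "\<epsilon> > 0" "\<And>a. \<chi>2 a \<noteq> \<eta>2 a \<Longrightarrow> \<epsilon> \<le> norm (\<chi>2 a - \<eta>2 a)"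
    using dirichlet_characters_gap[OF dir(2,4)] by blast
  \<comment> \<open>From \<open>p0\<close> on, \<open>p\<close> exceeds
    \<open>2 / \<epsilon>\<close>, so unequal values of \<open>\<chi>2\<close> and
    \<open>\<eta>2\<close> would differ by more than 2 after scaling by
    \<open>p ^ (k - 1) \<ge> p\<close>, while \<open>\<eta>1 - \<chi>1\<close> has norm at most
    2.\<close>
  define p0 where "p0 = Suc (nat \<lceil>2 / \<epsilon>\<rceil>)"
  have eq2: "\<chi>2 (int p) = \<eta>2 (int p)" if p: "p \<in> S" "p \<ge> p0" for p
  proof (rule ccontr)
    assume "\<chi>2 (int p) \<noteq> \<eta>2 (int p)"
    then have gap: "\<epsilon> \<le> norm (\<chi>2 (int p) - \<eta>2 (int p))" by (rule \<epsilon>(2))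
    have "real p > 2 / \<epsilon>" using p(2) unfolding p0_def by linarith
    then have "2 < \<epsilon> * real p" using \<epsilon>(1) by (simp add: pos_divide_less_eq mult.commute)
    also have "\<epsilon> * real p \<le> norm (\<chi>2 (int p) - \<eta>2 (int p)) * real p ^ (k - 1)"
    proof (rule mult_mono[OF gap])
      show "real p \<le> real p ^ (k - 1)"
        using k p(2) unfolding p0_def by (intro self_le_power) auto
    qed auto
    also have "\<dots> = norm ((\<chi>2 (int p) - \<eta>2 (int p)) * of_nat p ^ (k - 1))"
      by (simp add: norm_mult norm_power)
    also have "(\<chi>2 (int p) - \<eta>2 (int p)) * of_nat p ^ (k - 1) = \<eta>1 (int p) - \<chi>1 (int p)"
      using coeff[OF p(1)] kk by (simp add: algebra_simps)
    also have "norm \<dots> \<le> 2"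
      using norm_triangle_ineq4[of "\<eta>1 (int p)" "\<chi>1 (int p)"] le1(1)[of "int p"] le1(3)[of "int p"] by linarith
    finally show False by simp
  qed
  have eq1: "\<chi>1 (int p) = \<eta>1 (int p)" if p: "p \<in> S" "p \<ge> p0" for p
    using coeff[OF p(1)] eq2[OF p] kk by simp
  have "N1 = M1 \<and> \<chi>1 = \<eta>1"
    by (rule primitive_characters_eq_of_density[OF \<chi>(1) \<eta>(1) assms(3) c(1) D eq1])
  moreover have "N2 = M2 \<and> \<chi>2 = \<eta>2"
    by (rule primitive_characters_eq_of_density[OF \<chi>(2) \<eta>(2) assms(3) c(1) D eq2])
  ultimately show ?thesis using kk N N' \<chi>f \<chi>g f g by simp
qed

end
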